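(* Any algorithm that decides whether a connected strongly-proportional allocation exists for $n$ hungry agents with equal entitlements requires at least $n(n-1)/2$ queries.
   Context: The cake is $C=[0,1]$, to be divided among agents $[n]$. Each agent $i$ has a valuation function $V_i$ on the algebra generated by intervals of $C$ that is non-negative, finitely additive, normalized ($V_i(C)=1$), with $x\mapsto V_i([0,x])$ continuous. Agent $i$ is hungry if $V_i(X)>0$ for every interval $X$ of positive length. Equal entitlements means each agent has entitlement $w_i=1/n$. An allocation is a partition $C=X_1\sqcup\cdots\sqcup X_n$ into finite unions of closed intervals, pairwise disjoint except possibly at endpoints; it is connected if each $X_i$ is a single interval and strongly-proportional if $V_i(X_i)>w_i$ for all $i$. Algorithms access valuations only via queries (each counts as one): $\textsc{Eval}_i(x,y)=V_i([x,y])$; $\textsc{Mark}_i(x,r)$ returns the largest $z\in C$ with $V_i([x,z])=r$, or $\infty$ if $V_i([x,1])<r$. *)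

theory Defs
  imports "HOL-Analysis.Analysis"
begin

abbreviation cake :: "real set" where
  "cake \<equiv> {0..1}"

definition cake_algebra :: "real set set" where
  "cake_algebra = algebra cake hull {X. is_interval X \<and> X \<subseteq> cake}"

text \<open>Values of \<open>V\<close> outside \<^const>\<open>cake_algebra\<close> are unconstrained and never used.\<close>

definition valuation :: "(real set \<Rightarrow> real) \<Rightarrow> bool" where
  "valuation V \<longleftrightarrow>
     (\<forall>X\<in>cake_algebra. 0 \<le> V X) \<and>
     additive cake_algebra V \<and>
     V cake = 1 \<and>
     continuous_on cake (\<lambda>x. V {0..x})"

definition hungry :: "(real set \<Rightarrow> real) \<Rightarrow> bool" where
  "hungry V \<longleftrightarrow>
     (\<forall>X. is_interval X \<and> X \<subseteq> cake \<and> 0 < measure lborel X \<longrightarrow> 0 < V X)"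

definition hungry_instance :: "nat \<Rightarrow> (nat \<Rightarrow> real set \<Rightarrow> real) \<Rightarrow> bool" where
  "hungry_instance n V \<longleftrightarrow> (\<forall>i\<in>{1..n}. valuation (V i) \<and> hungry (V i))"


definition allocation :: "nat \<Rightarrow> (nat \<Rightarrow> real set) \<Rightarrow> bool" where
  "allocation n X \<longleftrightarrow>
     (\<forall>i\<in>{1..n}. \<exists>\<J>. finite \<J> \<and> (\<forall>J\<in>\<J>. \<exists>a b. a \<le> b \<and> J = {a..b}) \<and> X i = \<Union>\<J>) \<and>
     (\<Union>i\<in>{1..n}. X i) = cake \<and>
     (\<forall>i\<in>{1..n}. \<forall>j\<in>{1..n}. i \<noteq> j \<longrightarrow> X i \<inter> X j \<subseteq> frontier (X i) \<inter> frontier (X j))"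

definition connected_allocation :: "nat \<Rightarrow> (nat \<Rightarrow> real set) \<Rightarrow> bool" where
  "connected_allocation n X \<longleftrightarrow> allocation n X \<and> (\<forall>i\<in>{1..n}. is_interval (X i))"

definition strongly_proportional ::
  "nat \<Rightarrow> (nat \<Rightarrow> real) \<Rightarrow> (nat \<Rightarrow> real set \<Rightarrow> real) \<Rightarrow> (nat \<Rightarrow> real set) \<Rightarrow> bool" where
  "strongly_proportional n w V X \<longleftrightarrow> (\<forall>i\<in>{1..n}. V i (X i) > w i)"

definition equal_entitlements :: "nat \<Rightarrow> nat \<Rightarrow> real" where
  "equal_entitlements n i = 1 / real n"


datatype query = Eval nat real real | Mark nat real real

fun legal_query :: "nat \<Rightarrow> query \<Rightarrow> bool" where
  "legal_query n (Eval i x y) \<longleftrightarrow> i \<in> {1..n} \<and> 0 \<le> x \<and> x \<le> y \<and> y \<le> 1"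
| "legal_query n (Mark i x r) \<longleftrightarrow> i \<in> {1..n} \<and> x \<in> cake \<and> 0 \<le> r"

fun response :: "(nat \<Rightarrow> real set \<Rightarrow> real) \<Rightarrow> query \<Rightarrow> ereal" where
  "response V (Eval i x y) = ereal (V i {x..y})"
| "response V (Mark i x r) =
     (if V i {x..1} < r then \<infinity>
      else ereal (GREATEST z. z \<in> {x..1} \<and> V i {x..z} = r))"

text \<open>A deterministic adaptive algorithm: the next action is an arbitrary function of the
  queries and responses so far. No computability or uniformity in \<open>n\<close> is required, and repeated
  queries are counted again.\<close>

type_synonym history = "(query \<times> ereal) list"

datatype action = Ask query | Answer bool

type_synonym algorithm = "history \<Rightarrow> action"

inductive reaches :: "algorithm \<Rightarrow> (nat \<Rightarrow> real set \<Rightarrow> real) \<Rightarrow> history \<Rightarrow> bool"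
  for A V where
  start: "reaches A V []"
| step: "reaches A V h \<Longrightarrow> A h = Ask q \<Longrightarrow> reaches A V (h @ [(q, response V q)])"

definition halts_with ::
  "algorithm \<Rightarrow> (nat \<Rightarrow> real set \<Rightarrow> real) \<Rightarrow> history \<Rightarrow> bool \<Rightarrow> bool" where
  "halts_with A V h b \<longleftrightarrow> reaches A V h \<and> A h = Answer b"

definition decides ::
  "nat \<Rightarrow> ((nat \<Rightarrow> real set \<Rightarrow> real) \<Rightarrow> bool) \<Rightarrow> algorithm \<Rightarrow> bool" where
  "decides n P A \<longleftrightarrow>
     (\<forall>V. hungry_instance n V \<longrightarrow>
        (\<forall>h q. reaches A V h \<and> A h = Ask q \<longrightarrow> legal_query n q) \<and>
        (\<exists>h. halts_with A V h (P V)))"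

lemma reaches_prefix:
  assumes "reaches A V h" "reaches A V h'" "length h \<le> length h'"
  shows "h = take (length h) h'"
  using assms
proof (induction arbitrary: h' rule: reaches.induct)
  case start
  then show ?case by simp
next
  case (step h q)
  have "reaches A V (take (length h + 1) h') \<and> (length h < length h' \<longrightarrow>
          A (take (length h) h') = Ask (fst (h' ! length h)) \<and>
          snd (h' ! length h) = response V (fst (h' ! length h)))"
    using step.prems(1)
  proof (induction rule: reaches.induct)
    case start
    then show ?case by (simp add: reaches.start)
  next
    case (step h'' q)
    then show ?case
      by (cases "length h < length h''")
         (auto simp: nth_append not_less_eq_eq less_Suc_eq intro: reaches.step)
  qed
  moreover have "h = take (length h) h'"
    using step by simp
  ultimately show ?case
    using step by (auto simp: take_Suc_conv_app_nth prod_eq_iff)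
qed

text \<open>The run is unique, so the length of its final history is the number of queries made.\<close>

lemma halts_with_unique:
  assumes "halts_with A V h b" "halts_with A V h' b'"
  shows "h = h' \<and> b = b'"
proof -
  have *: "g = g'" if "halts_with A V g c" "halts_with A V g' c'" "length g \<le> length g'"
    for g g' c c'
  proof (rule ccontr)
    assume "g \<noteq> g'"
    have g: "g = take (length g) g'"
      using reaches_prefix that by (auto simp: halts_with_def)
    have "reaches A V g'" using that by (simp add: halts_with_def)
    hence "\<forall>k<length g'. \<exists>q. A (take k g') = Ask q"
    proof (induction rule: reaches.induct)
      case (step h q)
      then show ?case by (auto simp: less_Suc_eq)
    qed simp
    moreover have "length g < length g'"
      using g \<open>g \<noteq> g'\<close> that(3) by (metis le_neq_implies_less take_all_iff order_refl)
    ultimately show False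
      using that(1) g by (metis action.distinct(1) halts_with_def)
  qed
  have "h = h'" using *[of h b h' b'] *[of h' b' h b] assms linear[of "length h" "length h'"] by blast
  thus ?thesis using assms by (simp add: halts_with_def)
qed

end

theory Submission
  imports Defs
begin

text \<open>If every agent values pieces by their length, no connected strongly-proportional allocation
  exists, since the lengths of the pieces add up to \<open>1\<close>. A query reveals at most two points of the
  cumulative valuation \<open>x \<mapsto> V\<^sub>i [0,x]\<close> of a single agent. There are \<open>n(n-1)\<close> pairs of an agent \<open>i\<close> and
  an interior point \<open>k/n\<close>, so after fewer than \<open>n(n-1)/2\<close> queries some pair is unexplored. Shifting a
  little of agent \<open>i\<close>'s value from the right of \<open>k/n\<close> to its left is then invisible to the algorithm,
  yet it lets agent \<open>i\<close> be content with a piece shorter than \<open>1/n\<close> ending just before \<open>k/n\<close>, and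
  the length saved is distributed among the other agents.\<close>

section \<open>Length with value shifted across a point\<close>

text \<open>For \<open>e \<ge> 0\<close> this is the measure with density 3/2 on
  \<open>{p - e..p}\<close>, 1/2 on \<open>{p..p + e}\<close> and 1 elsewhere.\<close>

definition shifted_length :: "real \<Rightarrow> real \<Rightarrow> real set \<Rightarrow> real" where
  "shifted_length p e X =
     measure lborel X + measure lborel (X \<inter> {p - e..p}) / 2 - measure lborel (X \<inter> {p..p + e}) / 2"

lemma measure_lborel_Icc_max: "measure lborel {a..b::real} = max 0 (b - a)"
  by (cases "a \<le> b") auto

text \<open>Makes length the case \<open>e = 0\<close>, so that it inherits being a hungry
  valuation.\<close>

lemma shifted_length_0: "shifted_length p 0 = measure lborel"
proof
  fix X :: "real set"
  show "shifted_length p 0 X = measure lborel X"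
    by (cases "p \<in> X") (auto simp: shifted_length_def)
qed

lemma shifted_length_Icc:
  assumes "x \<le> y"
  shows "shifted_length p e {x..y} =
     y - x + max 0 (min y p - max x (p - e)) / 2 - max 0 (min y (p + e) - max x p) / 2"
  unfolding shifted_length_def Int_atLeastAtMost measure_lborel_Icc_max using assms by simp

text \<open>The Borel subsets of the cake form an algebra containing its subintervals, hence they
  contain the hull.\<close>

lemma cake_algebra_borel:
  assumes "X \<in> cake_algebra"
  shows "X \<in> sets borel" "X \<subseteq> cake"
proof -
  let ?B = "{X \<in> sets borel. X \<subseteq> cake}"
  have "algebra cake ?B"
    by (auto simp: algebra_iff_Un)
  moreover have "{X. is_interval X \<and> X \<subseteq> cake} \<subseteq> ?B"
    by (auto intro: real_interval_borel_measurable)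
  ultimately have "cake_algebra \<subseteq> ?B"
    unfolding cake_algebra_def by (intro hull_minimal)
  with assms show "X \<in> sets borel" "X \<subseteq> cake" by auto
qed

lemma fmeasurable_subset_cake: "X \<in> sets borel \<Longrightarrow> X \<subseteq> cake \<Longrightarrow> X \<in> fmeasurable lborel"
  by (rule fmeasurableI2[of cake]) (auto simp: fmeasurable_def)

text \<open>The density never drops below 1/2. Non-negativity, hungriness and strict monotonicity
  all rest on this.\<close>

lemma shifted_length_ge:
  assumes "X \<in> sets borel" "X \<subseteq> cake"
  shows "measure lborel X / 2 \<le> shifted_length p e X"
proof -
  have "measure lborel (X \<inter> {p..p + e}) \<le> measure lborel X"
    using assms by (intro measure_mono_fmeasurable fmeasurable_subset_cake) auto
  then show ?thesis
    using measure_nonneg[of lborel "X \<inter> {p - e..p}"] unfolding shifted_length_def by linarith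
qed

lemma shifted_length_Un:
  assumes "X \<in> sets borel" "X \<subseteq> cake" "Y \<in> sets borel" "Y \<subseteq> cake" "X \<inter> Y = {}"
  shows "shifted_length p e (X \<union> Y) = shifted_length p e X + shifted_length p e Y"
proof -
  have Un: "measure lborel ((X \<union> Y) \<inter> S) = measure lborel (X \<inter> S) + measure lborel (Y \<inter> S)"
    if "S \<in> sets borel" for S
  proof -
    have "X \<inter> S \<in> fmeasurable lborel" "Y \<inter> S \<in> fmeasurable lborel"
      using assms that by (auto intro!: fmeasurable_subset_cake)
    moreover have "(X \<inter> S) \<inter> (Y \<inter> S) = {}" using assms by auto
    ultimately show ?thesis
      by (simp add: measure_Un3 Int_Un_distrib2)
  qed
  show ?thesis
    using Un[of UNIV] Un[of "{p - e..p}"] Un[of "{p..p + e}"]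
    by (simp add: shifted_length_def field_simps)
qed

lemma valuation_shifted_length:
  assumes "0 \<le> e" "0 \<le> p - e" "p + e \<le> 1"
  shows "valuation (shifted_length p e)"
  unfolding valuation_def
proof (intro conjI ballI)
  fix X assume X: "X \<in> cake_algebra"
  show "0 \<le> shifted_length p e X"
    using shifted_length_ge[OF cake_algebra_borel[OF X], of p e] measure_nonneg[of lborel X] by linarith
next
  show "additive cake_algebra (shifted_length p e)"
    unfolding additive_def using cake_algebra_borel by (auto intro: shifted_length_Un)
next
  show "shifted_length p e cake = 1"
    using assms by (simp add: shifted_length_Icc)
next
  have "continuous_on cake (\<lambda>x. x - 0 + max 0 (min x p - max 0 (p - e)) / 2
      - max 0 (min x (p + e) - max 0 p) / 2)"
    by (intro continuous_intros) auto
  then show "continuous_on cake (\<lambda>x. shifted_length p e {0..x})"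
    by (rule continuous_on_eq) (auto simp: shifted_length_Icc)
qed

lemma hungry_shifted_length: "hungry (shifted_length p e)"
  unfolding hungry_def
proof (intro allI impI, elim conjE)
  fix X :: "real set"
  assume "is_interval X" "X \<subseteq> cake" "0 < measure lborel X"
  then show "0 < shifted_length p e X"
    using shifted_length_ge[of X p e] real_interval_borel_measurable[of X] by simp
qed

text \<open>With no endpoint strictly within \<open>e\<close> of \<open>p\<close>, the interval
  contains the whole window around \<open>p\<close> or misses its interior, so gain and loss
  cancel.\<close>

lemma shifted_length_Icc_outside:
  assumes "x \<le> y" "0 \<le> e" "e \<le> \<bar>x - p\<bar>" "e \<le> \<bar>y - p\<bar>"
  shows "shifted_length p e {x..y} = y - x"
proof -
  consider "y \<le> p - e" | "x \<le> p - e" "p + e \<le> y" | "p + e \<le> x"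
    using assms by linarith
  then show ?thesis
    using assms by cases (simp_all add: shifted_length_Icc)
qed

lemma shifted_length_strict_mono:
  assumes "0 \<le> x" "x \<le> y" "y < z" "z \<le> 1"
  shows "shifted_length p e {x..y} < shifted_length p e {x..z}"
proof -
  have "{x..z} = {x..y} \<union> {y<..z}" using assms by auto
  then have "shifted_length p e {x..z} = shifted_length p e {x..y} + shifted_length p e {y<..z}"
    using assms by (auto intro!: shifted_length_Un)
  moreover have "(z - y) / 2 \<le> shifted_length p e {y<..z}"
    using shifted_length_ge[of "{y<..z}" p e] assms by (simp add: subset_eq)
  ultimately show ?thesis using assms by simp
qed

text \<open>Leaves at most one candidate for the \<open>GREATEST\<close> in a \<open>Mark\<close>
  response.\<close>

lemma shifted_length_inj:
  assumes "0 \<le> x" "y \<in> {x..1}" "z \<in> {x..1}" "shifted_length p e {x..y} = shifted_length p e {x..z}"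
  shows "y = z"
  using shifted_length_strict_mono[of x y z p e] shifted_length_strict_mono[of x z y p e] assms
  by (cases y z rule: linorder_cases) auto

section \<open>Indistinguishability\<close>

fun query_agent :: "query \<Rightarrow> nat" where
  "query_agent (Eval i x y) = i"
| "query_agent (Mark i x r) = i"

text \<open>The response to \<open>Mark\<close> under the length valuation is \<open>x + r\<close>, or \<open>\<infinity>\<close> if \<open>x + r > 1\<close>.\<close>

fun query_points :: "query \<Rightarrow> real set" where
  "query_points (Eval i x y) = {x, y}"
| "query_points (Mark i x r) = {x, x + r}"

lemma response_shifted_length:
  assumes "legal_query n q" "0 \<le> e" "0 \<le> p - e" "p + e \<le> 1"
    and "query_agent q = i \<Longrightarrow> \<forall>t\<in>query_points q. e \<le> \<bar>t - p\<bar>"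
  shows "response ((\<lambda>_. measure lborel)(i := shifted_length p e)) q = response (\<lambda>_. measure lborel) q"
proof (cases "query_agent q = i")
  case False
  then show ?thesis by (cases q) auto
next
  case True
  then have out: "\<forall>t\<in>query_points q. e \<le> \<bar>t - p\<bar>" by (rule assms)
  show ?thesis
  proof (cases q)
    case (Eval j x y)
    then show ?thesis
      using assms True out by (auto simp: shifted_length_Icc_outside)
  next
    case (Mark j x r)
    have x: "0 \<le> x" "x \<le> 1" "0 \<le> r" and xr: "e \<le> \<bar>x - p\<bar>" "e \<le> \<bar>x + r - p\<bar>"
      using Mark assms out by auto
    \<comment> \<open>As \<open>p + e \<le> 1\<close>, the right end of the cake is also outside the
      window; hence \<open>Mark\<close> returns \<infinity> under both valuations for the same
      \<open>r\<close>.\<close>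
    have 1: "shifted_length p e {x..1} = 1 - x"
      using x xr assms by (intro shifted_length_Icc_outside) auto
    have "shifted_length p e {x..x + r} = r"
      using x xr assms shifted_length_Icc_outside[of x "x + r"] by auto
    then have "shifted_length p e {x..z} = r \<longleftrightarrow> z = x + r" if "z \<in> {x..1}" "x + r \<le> 1" for z
      using that x shifted_length_inj[of x z "x + r" p e] by auto
    then have "(GREATEST z. z \<in> {x..1} \<and> shifted_length p e {x..z} = r)
        = (GREATEST z. z \<in> {x..1} \<and> measure lborel {x..z} = r)" if "x + r \<le> 1"
      using that x by (intro arg_cong[where f = Greatest] ext conj_cong refl) auto
    then show ?thesis
      using Mark True 1 x by auto
  qed
qed

text \<open>An algorithm sees only its history, so equal responses along a run let the other
  instance replay it.\<close>

lemma reaches_cong: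
  assumes "reaches A V h" "\<And>q r. (q, r) \<in> set h \<Longrightarrow> response V' q = response V q"
  shows "reaches A V' h"
  using assms
proof (induction rule: reaches.induct)
  case start
  show ?case by (rule reaches.start)
next
  case (step h q)
  have "response V' q = response V q" by (rule step.prems[of q "response V q"]) simp
  moreover have "reaches A V' h" by (rule step.IH) (metis UnCI set_append step.prems)
  ultimately show ?case
    using reaches.step[of A V' h q] step.hyps by simp
qed

text \<open>Transfers legality, which \<open>decides\<close> grants for queries about to be asked,
  to the queries recorded in a history.\<close>

lemma reaches_asked:
  assumes "reaches A V h" "(q, r) \<in> set h"
  shows "\<exists>h'. reaches A V h' \<and> A h' = Ask q"
  using assms by (induction rule: reaches.induct) auto

section \<open>Existence and non-existence of allocations\<close>

lemma no_strongly_proportional_length: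
  assumes "n \<ge> 1" "connected_allocation n X"
  shows "\<not> strongly_proportional n (equal_entitlements n) (\<lambda>_. measure lborel) X"
proof
  assume sp: "strongly_proportional n (equal_entitlements n) (\<lambda>_. measure lborel) X"
  have iv: "is_interval (X i)" "X i \<subseteq> cake" if "i \<in> {1..n}" for i
    using assms that by (auto simp: connected_allocation_def allocation_def)
  have borel: "X i \<in> sets borel" if "i \<in> {1..n}" for i
    using iv that by (auto intro: real_interval_borel_measurable)
  have fm: "X i \<in> lmeasurable" if "i \<in> {1..n}" for i
    using fmeasurable_subset_cake[OF borel iv(2)] that lmeasurable_iff_integrable
    by (auto simp: fmeasurable_def)
  \<comment> \<open>Overlaps lie in frontiers of convex sets, which are null, so lengths add as for
    disjoint pieces.\<close>
  have "negligible (X i \<inter> X j)" if "i \<in> {1..n}" "j \<in> {1..n}" "i \<noteq> j" for i j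
  proof -
    have "negligible (frontier (X i))"
      using iv that by (intro negligible_convex_frontier) (simp add: is_interval_convex)
    moreover have "X i \<inter> X j \<subseteq> frontier (X i)"
      using assms that by (auto simp: connected_allocation_def allocation_def)
    ultimately show ?thesis by (rule negligible_subset)
  qed
  then have "measure lebesgue (\<Union>i\<in>{1..n}. X i) = (\<Sum>i\<in>{1..n}. measure lebesgue (X i))"
    using fm by (intro measure_negligible_finite_Union_image) (auto simp: pairwise_def)
  then have "1 = (\<Sum>i\<in>{1..n}. measure lborel (X i))"
    using assms borel by (simp add: connected_allocation_def allocation_def)
  moreover have "(\<Sum>i\<in>{1..n}. measure lborel (X i)) > (\<Sum>i\<in>{1..n}. 1 / real n)"
    using sp assms by (intro sum_strict_mono) (auto simp: strongly_proportional_def equal_entitlements_def)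
  ultimately show False using assms by simp
qed

lemma frontier_Icc_real: "a \<le> b \<Longrightarrow> frontier {a..b::real} = {a, b}"
  using frontier_cbox[of a b] by auto

text \<open>Here \<open>f i\<close> is the position, counted from the left starting at 1, of the
  piece of agent \<open>i\<close>.\<close>

lemma connected_allocation_cuts:
  fixes c :: "nat \<Rightarrow> real"
  assumes c: "c 0 = 0" "c n = 1" "\<And>j. j < n \<Longrightarrow> c j < c (Suc j)"
    and f: "bij_betw f {1..n} {1..n}"
  shows "connected_allocation n (\<lambda>i. {c (f i - 1)..c (f i)})"
proof -
  have mono: "c j \<le> c k" if "j \<le> k" "k \<le> n" for j k
    using that
  proof (induction k rule: dec_induct)
    case (step k)
    then show ?case using c(3)[of k] by auto
  qed simp
  have pos: "f i \<in> {1..n}" if "i \<in> {1..n}" for i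
    using f that by (auto dest: bij_betwE)
  have le: "c (f i - 1) \<le> c (f i)" if "i \<in> {1..n}" for i
    using pos[OF that] by (intro mono) auto
  have "{0..c m} \<subseteq> (\<Union>j\<in>{1..m}. {c (j - 1)..c j})" if "1 \<le> m" "m \<le> n" for m
    using that
  proof (induction m rule: dec_induct)
    case base
    then show ?case using c by auto
  next
    case (step m)
    have split: "{0..c (Suc m)} \<subseteq> {0..c m} \<union> {c m..c (Suc m)}" by auto
    have last: "{c m..c (Suc m)} \<subseteq> (\<Union>j\<in>{1..Suc m}. {c (j - 1)..c j})"
      by (rule order_trans[OF _ UN_upper[of "Suc m"]]) auto
    have "(\<Union>j\<in>{1..m}. {c (j - 1)..c j}) \<subseteq> (\<Union>j\<in>{1..Suc m}. {c (j - 1)..c j})"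
      by (rule UN_mono) auto
    then have "{0..c m} \<subseteq> (\<Union>j\<in>{1..Suc m}. {c (j - 1)..c j})"
      by (rule order_trans[rotated]) (use step in simp)
    then show ?case using last by (rule order_trans[OF split Un_least])
  qed
  from this[of n] have "cake \<subseteq> (\<Union>j\<in>{1..n}. {c (j - 1)..c j})"
    using c by (cases n) auto
  moreover have "{c (j - 1)..c j} \<subseteq> cake" if "j \<in> {1..n}" for j
    using mono[of 0 "j - 1"] mono[of j n] that c by auto
  ultimately have "(\<Union>j\<in>{1..n}. {c (j - 1)..c j}) = cake" by blast
  then have "(\<Union>j\<in>f ` {1..n}. {c (j - 1)..c j}) = cake"
    using f by (simp add: bij_betw_def)
  then have cover: "(\<Union>i\<in>{1..n}. {c (f i - 1)..c (f i)}) = cake"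
    by (simp add: image_image)
  have meet: "{c (f i - 1)..c (f i)} \<inter> {c (f j - 1)..c (f j)}
      \<subseteq> {c (f i - 1), c (f i)} \<inter> {c (f j - 1), c (f j)}"
    if ij: "i \<in> {1..n}" "j \<in> {1..n}" "f i < f j" for i j
  proof -
    \<comment> \<open>The piece further left ends no later than the other starts, so a common point
      is an endpoint of both.\<close>
    have "c (f i) \<le> c (f j - 1)"
      using pos[OF ij(2)] ij(3) by (intro mono) auto
    then show ?thesis by auto
  qed
  have frontiers: "{c (f i - 1)..c (f i)} \<inter> {c (f j - 1)..c (f j)}
      \<subseteq> frontier {c (f i - 1)..c (f i)} \<inter> frontier {c (f j - 1)..c (f j)}"
    if ij: "i \<in> {1..n}" "j \<in> {1..n}" "i \<noteq> j" for i j
  proof -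
    have "f i \<noteq> f j" using f ij by (auto simp: bij_betw_def dest: inj_onD)
    then consider "f i < f j" | "f j < f i" by linarith
    then show ?thesis
      unfolding frontier_Icc_real[OF le[OF ij(1)]] frontier_Icc_real[OF le[OF ij(2)]]
      by cases (use meet[OF ij(1,2)] meet[OF ij(2,1)] in \<open>simp_all only: Int_commute\<close>)
  qed
  have pieces: "\<exists>\<J>. finite \<J> \<and> (\<forall>J\<in>\<J>. \<exists>a b. a \<le> b \<and> J = {a..b}) \<and>
      {c (f i - 1)..c (f i)} = \<Union>\<J>" if "i \<in> {1..n}" for i
    using le[OF that] by (intro exI[of _ "{{c (f i - 1)..c (f i)}}"]) auto
  show ?thesis
    unfolding connected_allocation_def allocation_def
    by (intro conjI ballI impI pieces cover frontiers is_interval_cc)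
qed

text \<open>Agent \<open>i\<close> gets the piece at position \<open>k\<close>, ending just left of
  \<open>k / n\<close>; its bonus there exceeds the length \<open>(n - 1) * d\<close> it gives up so
  that every other piece gains \<open>d\<close>.\<close>

lemma strongly_proportional_shifted_length:
  fixes i k n :: nat
  assumes i: "i \<in> {1..n}" and k: "1 \<le> k" "k < n" and e: "0 < e" "e \<le> 1 / (2 * real n)"
  shows "\<exists>X. connected_allocation n X \<and> strongly_proportional n (equal_entitlements n)
    ((\<lambda>_. measure lborel)(i := shifted_length (k / n) e)) X"
proof -
  define p where "p = real k / real n"
  \<comment> \<open>Since \<open>n * d = e / 4\<close>, agent \<open>i\<close> loses at most
    \<open>e / 4\<close> in length, while its bonus is at least
    \<open>(3 / 4 * e) / 2\<close>.\<close>
  define d where "d = e / (4 * real n)"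
  \<comment> \<open>Cuts before \<open>k\<close> are measured from the left end, the others from the
    right end, so piece \<open>k\<close> alone absorbs the slack.\<close>
  define c where
    "c j = (if j < k then real j * (1 / n + d) else 1 - (real n - real j) * (1 / n + d))" for j :: nat
  \<comment> \<open>The transposition of \<open>i\<close> and \<open>k\<close>, which is its own
    inverse.\<close>
  define f where "f m = (if m = i then k else if m = k then i else m)" for m
  have n: "real n > 0" using k by simp
  have d: "0 < d" "real n * d = e / 4" using e n by (auto simp: d_def)
  have dm: "(real n - real j) * d \<le> e / 4" "real j * d \<le> e / 4" if "j \<le> n" for j
    using that d mult_right_mono[of "real j" "real n" d] by (auto simp: algebra_simps)
  have en: "e \<le> (1 / n) / 2" using e by simp
  have other: "c j - c (j - 1) = 1 / n + d" if "j \<in> {1..n}" "j \<noteq> k" for j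
    using that n by (cases "j < k") (auto simp: c_def of_nat_diff field_simps)
  have own: "c (k - 1) = p - 1 / n + real (k - 1) * d" "c k = p - (real n - real k) * d"
    using k n by (auto simp: c_def p_def of_nat_diff field_simps)
  have own_bounds: "c (k - 1) \<le> p - e" "c k \<le> p" "p - e / 4 \<le> c k"
  proof -
    have "real (k - 1) * d \<le> e / 4" "(real n - real k) * d \<le> e / 4" "0 \<le> (real n - real k) * d"
      using dm[of "k - 1"] dm[of k] k d by auto
    then show "c (k - 1) \<le> p - e" "c k \<le> p" "p - e / 4 \<le> c k"
      using own en e by linarith+
  qed
  have "c j < c (Suc j)" if "j < n" for j
  proof (cases "Suc j = k")
    case True
    then show ?thesis using own_bounds e by auto
  next
    case False
    then have "c (Suc j) - c j = 1 / n + d" using other[of "Suc j"] that by simp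
    moreover have "0 < 1 / real n" using n by simp
    ultimately show ?thesis using d(1) by linarith
  qed
  moreover have "c 0 = 0" "c n = 1" using k by (auto simp: c_def)
  moreover have f: "bij_betw f {1..n} {1..n}"
    using i k by (intro bij_betw_byWitness[of _ f]) (auto simp: f_def)
  ultimately have "connected_allocation n (\<lambda>m. {c (f m - 1)..c (f m)})"
    by (intro connected_allocation_cuts) auto
  moreover have "((\<lambda>_. measure lborel)(i := shifted_length p e)) m {c (f m - 1)..c (f m)} > 1 / n"
    if m: "m \<in> {1..n}" for m
  proof (cases "m = i")
    case True
    \<comment> \<open>The piece starts at or before \<open>p - e\<close> and ends at or before
      \<open>p\<close>, so it meets the cheap half of the window in at most the null point
      \<open>p\<close>.\<close>
    have "shifted_length p e {c (k - 1)..c k} = c k - c (k - 1) + (c k - (p - e)) / 2"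
      using own_bounds e by (subst shifted_length_Icc) auto
    also have "\<dots> > 1 / n"
    proof -
      have "c k - c (k - 1) = 1 / n - (real n - 1) * d"
        using own k by (simp add: of_nat_diff algebra_simps)
      moreover have "(real n - 1) * d \<le> e / 4" using dm[of 1] k by simp
      ultimately have "1 / n - e / 4 \<le> c k - c (k - 1)" by linarith
      moreover have "e / 4 < (c k - (p - e)) / 2" using own_bounds(3) e(1) by (simp add: field_simps)
      ultimately show ?thesis by linarith
    qed
    finally show ?thesis using True by (simp add: f_def)
  next
    case False
    then have "f m \<in> {1..n}" "f m \<noteq> k"
      using i m by (auto simp: f_def)
    then have "1 / n < c (f m) - c (f m - 1)" using other[of "f m"] d(1) by linarith
    also have "\<dots> \<le> measure lborel {c (f m - 1)..c (f m)}"
      unfolding measure_lborel_Icc_max by simp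
    finally show ?thesis using False by simp
  qed
  ultimately show ?thesis
    unfolding strongly_proportional_def equal_entitlements_def p_def by blast
qed

section \<open>Counting explored points and the adversary argument\<close>

lemma card_query_points:
  "finite (query_points q)" "card (query_points q) \<le> 2"
  by (cases q; simp add: card_insert_if)+

lemma unexplored_point:
  assumes "length qs < n * (n - 1) div 2"
  obtains i k where "i \<in> {1..n}" "1 \<le> k" "k < n"
    "\<And>q. q \<in> set qs \<Longrightarrow> query_agent q = i \<Longrightarrow> real k / real n \<notin> query_points q"
proof -
  \<comment> \<open>\<open>T\<close> holds the explored pairs, at most two per query;
    \<open>G\<close> holds all \<open>n * (n - 1)\<close> candidate pairs.\<close>
  define T where "T = (\<Union>q\<in>set qs. Pair (query_agent q) ` query_points q)"
  define G where "G = (\<lambda>(i, k). (i, real k / real n)) ` ({1..n} \<times> {1..n - 1})"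
  have "n > 0" using assms by (cases n) auto
  then have "card G = n * (n - 1)"
    unfolding G_def by (subst card_image) (auto simp: inj_on_def)
  moreover have "card T \<le> (\<Sum>q\<in>set qs. 2)"
    unfolding T_def using card_query_points
    by (intro order_trans[OF card_UN_le] sum_mono) (auto intro: order_trans[OF card_image_le])
  then have "card T \<le> 2 * length qs"
    using card_length[of qs] by simp
  ultimately have "card T < card G" using assms by linarith
  moreover have "finite T" unfolding T_def using card_query_points by auto
  ultimately have "\<not> G \<subseteq> T" using card_mono[of T G] by auto
  then obtain x where "x \<in> G" "x \<notin> T" by blast
  then obtain i k where ik: "i \<in> {1..n}" "k \<in> {1..n - 1}" "(i, real k / real n) \<notin> T"
    unfolding G_def by auto
  show ?thesis
  proof (rule that[of i k])
    show "real k / real n \<notin> query_points q" if "q \<in> set qs" "query_agent q = i" for q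
      using ik that unfolding T_def by auto
  qed (use ik in auto)
qed

theorem theorem3:
  fixes n :: nat and A :: algorithm
  assumes "n \<ge> 1"
    and "decides n
           (\<lambda>V. \<exists>X. connected_allocation n X \<and>
                  strongly_proportional n (equal_entitlements n) V X) A"
  shows "\<exists>V h b. hungry_instance n V \<and> halts_with A V h b \<and> n * (n - 1) div 2 \<le> length h"
proof -
  let ?P = "\<lambda>V. \<exists>X. connected_allocation n X \<and>
                  strongly_proportional n (equal_entitlements n) V X"
  \<comment> \<open>The same hard instance serves against every algorithm.\<close>
  let ?U = "\<lambda>_::nat. measure lborel :: real set \<Rightarrow> real"
  have U: "valuation (measure lborel)" "hungry (measure lborel)"
    using valuation_shifted_length[of 0 0] hungry_shifted_length[of 0 0] by (auto simp: shifted_length_0)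
  then have "hungry_instance n ?U" by (simp add: hungry_instance_def)
  with assms obtain h where h: "halts_with A ?U h (?P ?U)"
    and legal: "\<And>h q. reaches A ?U h \<Longrightarrow> A h = Ask q \<Longrightarrow> legal_query n q"
    unfolding decides_def by blast
  have no: "\<not> ?P ?U" using no_strongly_proportional_length assms by blast
  have "n * (n - 1) div 2 \<le> length h"
  proof (rule ccontr)
    assume "\<not> n * (n - 1) div 2 \<le> length h"
    then obtain i k where ik: "i \<in> {1..n}" "1 \<le> k" "k < n"
      and unexplored: "\<And>q. q \<in> set (map fst h) \<Longrightarrow> query_agent q = i \<Longrightarrow>
        real k / real n \<notin> query_points q"
      using unexplored_point[of "map fst h" n] by auto
    define p where "p = real k / real n"
    define D where "D = (\<Union>q\<in>{q \<in> set (map fst h). query_agent q = i}. (\<lambda>t. \<bar>t - p\<bar>) ` query_points q)"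
    \<comment> \<open>No larger than the distance from \<open>p\<close> to any point explored for
      agent \<open>i\<close>, and at most half of \<open>1 / n\<close>, which keeps the window
      inside the cake.\<close>
    define e where "e = Min (insert (1 / (2 * real n)) D)"
    have "finite D" unfolding D_def using card_query_points by auto
    moreover have "\<forall>t\<in>D. t > 0" using unexplored unfolding D_def p_def by fastforce
    ultimately have e: "0 < e" "e \<le> 1 / (2 * real n)" and eD: "\<And>t. t \<in> D \<Longrightarrow> e \<le> t"
      using assms by (auto simp: e_def)
    have "e \<le> (1 / n) / 2" using e by simp
    moreover have "1 / n \<le> p" "p + 1 / n \<le> 1" using ik by (auto simp: p_def field_simps)
    ultimately have pe: "0 \<le> p - e" "p + e \<le> 1" using e by auto
    let ?V = "?U(i := shifted_length p e)"
    have V: "hungry_instance n ?V"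
      using U valuation_shifted_length[of e p] hungry_shifted_length pe e
      by (auto simp: hungry_instance_def)
    have "response ?V q = response ?U q" if "(q, r) \<in> set h" for q r
    proof (rule response_shifted_length)
      show "legal_query n q"
        using reaches_asked[of A ?U h q r] that h legal by (auto simp: halts_with_def)
      show "\<forall>t\<in>query_points q. e \<le> \<bar>t - p\<bar>" if "query_agent q = i"
        using eD that \<open>(q, r) \<in> set h\<close> unfolding D_def by force
    qed (use e pe in auto)
    then have "reaches A ?V h"
      using reaches_cong[of A ?U h ?V] h by (auto simp: halts_with_def)
    \<comment> \<open>The replayed run ends in the answer for \<open>?U\<close>, although an
      allocation exists for \<open>?V\<close>; uniqueness of the run gives the
      contradiction.\<close>
    then have "halts_with A ?V h False"
      using h no by (auto simp: halts_with_def)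
    moreover have "?P ?V"
      using strongly_proportional_shifted_length[of i n k e] ik e unfolding p_def by blast
    then have "?P ?V = True" by simp
    moreover obtain h' where "halts_with A ?V h' (?P ?V)"
      using assms V unfolding decides_def by blast
    ultimately show False using halts_with_unique by metis
  qed
  with \<open>hungry_instance n ?U\<close> h show ?thesis by blast
qed

end
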